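(* Let $K_1$ and $K_2$ be nonempty convex sets in $\mathbb{R}^n$ and let $m$ be an integer. Assume that one of the following holds: (a) $K_1$ and $K_2$ are both compact and $2 \le m \le n-1$; or (b) $K_1$ and $K_2$ are both closed and $3 \le m \le n-1$. Then the following two conditions are equivalent: 1) $K_1$ and $K_2$ are homothetic; 2) for every $m$-dimensional plane $L \subset \mathbb{R}^n$, the orthogonal projections $\pi_L(K_1)$ and $\pi_L(K_2)$ are homothetic, where the homothety ratio may depend on $L$.
   Context: Nonempty sets $X_1, X_2 \subset \mathbb{R}^n$ are called homothetic if $X_1 = z + \lambda X_2$ for some point $z \in \mathbb{R}^n$ and some scalar $\lambda \neq 0$ (the homothety ratio); $\lambda$ is not required to be positive. A plane in $\mathbb{R}^n$ is a set of the form $z + L_0$, where $z \in \mathbb{R}^n$ and $L_0$ is a linear subspace of $\mathbb{R}^n$; its dimension is that of $L_0$. For a plane $L \subset \mathbb{R}^n$ and a set $X \subset \mathbb{R}^n$, $\pi_L(X)$ denotes the orthogonal projection of $X$ on $L$. *)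

theory Defs
  imports "HOL-Analysis.Analysis"
begin

text \<open>The ratio may be negative. All uses below are for nonempty sets.\<close>

definition homothetic :: "'a::real_vector set \<Rightarrow> 'a set \<Rightarrow> bool" where
  "homothetic X1 X2 \<longleftrightarrow> (\<exists>z c. c \<noteq> 0 \<and> X1 = (\<lambda>x. z + c *\<^sub>R x) ` X2)"

definition plane :: "nat \<Rightarrow> 'a::euclidean_space set \<Rightarrow> bool" where
  "plane m L \<longleftrightarrow> (\<exists>z L0. subspace L0 \<and> dim L0 = m \<and> L = (+) z ` L0)"

text \<open>The foot of the perpendicular from \<open>x\<close> to a plane \<open>L\<close>; differences \<open>u - v\<close>
  of points of \<open>L\<close> range over the direction space of \<open>L\<close>. Lemma \<open>plane_orth_foot_ex1\<close>
  justifies the definite description.\<close>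

definition orth_proj :: "'a::euclidean_space set \<Rightarrow> 'a \<Rightarrow> 'a" where
  "orth_proj L x = (THE y. y \<in> L \<and> (\<forall>u\<in>L. \<forall>v\<in>L. orthogonal (x - y) (u - v)))"

lemma plane_iff_affine: "plane m L \<longleftrightarrow> affine L \<and> aff_dim L = int m"
proof
  assume "plane m L"
  then obtain z L0 where "subspace L0" "dim L0 = m" "L = (+) z ` L0"
    unfolding plane_def by blast
  then show "affine L \<and> aff_dim L = int m"
    by (metis aff_dim_subspace aff_dim_translation_eq affine_translation subspace_imp_affine)
next
  assume L: "affine L \<and> aff_dim L = int m"
  then obtain z where "z \<in> L"
    by fastforce
  define L0 where "L0 = (+) (- z) ` L"
  have "subspace L0"
    unfolding L0_def using L \<open>z \<in> L\<close> by (blast intro: affine_diffs_subspace)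
  moreover have "int (dim L0) = int m"
    using L aff_dim_subspace[OF \<open>subspace L0\<close>] unfolding L0_def by (metis aff_dim_translation_eq)
  moreover have "L = (+) z ` L0"
    unfolding L0_def by (simp add: image_image)
  ultimately show "plane m L"
    unfolding plane_def by auto
qed

lemma plane_orth_foot_ex1:
  fixes L :: "'a::euclidean_space set"
  assumes "plane m L"
  shows "\<exists>!y. y \<in> L \<and> (\<forall>u\<in>L. \<forall>v\<in>L. orthogonal (x - y) (u - v))"
proof -
  from assms obtain z L0 where L0: "subspace L0" and L: "L = (+) z ` L0"
    unfolding plane_def by blast
  obtain a b where a: "a \<in> span L0" and b: "\<And>w. w \<in> span L0 \<Longrightarrow> orthogonal b w"
    and ab: "x - z = a + b"
    using orthogonal_subspace_decomp_exists[of L0 "x - z"] by metis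
  show ?thesis
  proof (rule ex1I)
    have eq: "x - (z + a) = b"
      using ab by (simp add: algebra_simps)
    have aL0: "a \<in> L0"
      using a L0 by (simp add: span_eq_iff[THEN iffD2])
    show "z + a \<in> L \<and> (\<forall>u\<in>L. \<forall>v\<in>L. orthogonal (x - (z + a)) (u - v))"
      unfolding eq using aL0 b by (auto simp: L intro!: b span_diff intro: span_base)
  next
    fix y assume y: "y \<in> L \<and> (\<forall>u\<in>L. \<forall>v\<in>L. orthogonal (x - y) (u - v))"
    then obtain w where w: "w \<in> L0" "y = z + w"
      by (auto simp: L)
    have aL0: "a \<in> L0"
      using a L0 by (simp add: span_eq_iff[THEN iffD2])
    have "orthogonal (x - y) ((z + a) - (z + w))"
      using y w aL0 unfolding L by blast
    then have "orthogonal (x - y) (a - w)"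
      by simp
    moreover have "orthogonal b (a - w)"
      using b a w(1) by (intro b span_diff) (auto intro: span_base)
    moreover have "a - w = (x - y) - b"
      using ab w(2) by (simp add: algebra_simps)
    ultimately have "orthogonal (a - w) (a - w)"
      by (simp add: orthogonal_def inner_diff_left)
    then show "y = z + a"
      using w(2) by (simp add: orthogonal_self)
  qed
qed

end

theory Submission
  imports Defs
begin

text \<open>
  A closed convex set is determined by its support function, and projecting orthogonally on a
  subspace \<open>S\<close> restricts that function to \<open>S\<close>. Write \<open>h1\<close>, \<open>h2\<close> for the support functions of \<open>K1\<close>,
  \<open>K2\<close>. That projections on all \<open>m\<close>-dimensional planes are homothetic yields, for every
  subspace \<open>S\<close> of dimension at most \<open>m\<close>, a sign, a factor \<open>c > 0\<close> and a vector \<open>z\<close> such that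
  \<open>h1 (u) = \<langle>u, z\<rangle> + c h2 (\<plusminus> u)\<close> for \<open>u\<close> in \<open>S\<close>, where both sides may be infinite
  (\<open>support_match_of_homothetic_projections\<close>). What has to be shown is that sign, factor and
  vector can be chosen independently of \<open>S\<close>; then \<open>K1\<close> and \<open>\<plusminus> K2\<close> agree up to translation and
  scaling. The vector is the easy part: once sign and factor are fixed, \<open>h1 - c h2\<close> is additive on
  the cone where it is finite, hence an inner product (\<open>additive_on_cone_imp_inner\<close>). For the
  rest, let \<open>B\<close> be the barrier cone of \<open>K1\<close>, where \<open>h1\<close> is finite.

  Suppose first that \<open>B\<close> is not a subspace. This excludes compactness, so \<open>m \<ge> 3\<close>. A
  direction \<open>x\<close> in \<open>B\<close> with \<open>- x\<close> not in \<open>B\<close> fixes the sign on all subspaces through it. The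
  additivity defects \<open>h (p) + h (q) - h (p + q)\<close> are blind to the vector \<open>z\<close>, so on each such
  subspace of dimension \<open>3\<close> the defects of \<open>K1\<close> are proportional to those of \<open>\<plusminus> K2\<close>, with the
  factor \<open>c\<close> of that subspace. Two pairs of vectors can be linked by
  a short chain of overlapping triples, which makes \<open>c\<close> a global constant
  (\<open>common_defect_ratio\<close>, \<open>support_match_UNIV_of_pointed_barrier\<close>).

  Suppose now that \<open>B\<close> is a subspace, as for compact sets. The widths \<open>h (u) + h (- u)\<close> are
  blind to sign and vector, and any two directions span a plane, so the factor is a global constant
  \<open>\<mu>\<close>. On each plane in \<open>B\<close> one of the two continuous functions \<open>h1 (u) - \<mu> h2 (u)\<close> and
  \<open>h1 (u) - \<mu> h2 (- u)\<close> is linear. If neither were linear globally, each would fail to be linear on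
  a plane near which the other one is a linear functional, and both would fail on a plane
  that crosses these two regions (\<open>additive_dichotomy\<close>,
  \<open>support_match_UNIV_of_barrier_subspace\<close>).
\<close>

section \<open>Orthogonal projection on a plane\<close>

lemma orth_proj_foot:
  assumes "plane m L"
  shows "orth_proj L x \<in> L"
    and "u \<in> L \<Longrightarrow> v \<in> L \<Longrightarrow> orthogonal (x - orth_proj L x) (u - v)"
proof -
  have *: "orth_proj L x \<in> L \<and> (\<forall>u\<in>L. \<forall>v\<in>L. orthogonal (x - orth_proj L x) (u - v))"
    unfolding orth_proj_def by (rule theI'[OF plane_orth_foot_ex1[OF assms]])
  show "orth_proj L x \<in> L"
    using * ..
  show "orthogonal (x - orth_proj L x) (u - v)" if "u \<in> L" "v \<in> L"
    using * that by blast
qed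

lemma orth_proj_eqI:
  assumes "plane m L" "y \<in> L" "\<And>u v. u \<in> L \<Longrightarrow> v \<in> L \<Longrightarrow> orthogonal (x - y) (u - v)"
  shows "orth_proj L x = y"
  unfolding orth_proj_def
  by (rule the1_equality[OF plane_orth_foot_ex1[OF assms(1)]]) (use assms(2,3) in blast)

text \<open>The projection is an affine map, because the defining orthogonality relation is linear in
  the point and its foot. Subtracting the foot of \<open>0\<close> keeps the coefficients of feet summing
  to \<open>1\<close>, so that the right-hand side lies in \<open>L\<close> even when \<open>L\<close> misses the origin.\<close>
lemma orth_proj_affine_comb:
  assumes "plane m L"
  shows "orth_proj L (z + c *\<^sub>R x) =
    orth_proj L z - c *\<^sub>R orth_proj L 0 + c *\<^sub>R orth_proj L x"
proof (rule orth_proj_eqI[OF assms])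
  have "affine L"
    using assms plane_iff_affine by blast
  from mem_affine_3_minus[OF this orth_proj_foot(1)[OF assms] orth_proj_foot(1)[OF assms]
      orth_proj_foot(1)[OF assms], of z c x 0]
  show "orth_proj L z - c *\<^sub>R orth_proj L 0 + c *\<^sub>R orth_proj L x \<in> L"
    by (simp add: algebra_simps)
next
  fix u v assume "u \<in> L" "v \<in> L"
  then have "(z - orth_proj L z) \<bullet> (u - v) = 0" "(x - orth_proj L x) \<bullet> (u - v) = 0"
    "(0 - orth_proj L 0) \<bullet> (u - v) = 0"
    using orth_proj_foot(2)[OF assms] by (simp_all only: orthogonal_def)
  moreover have "z + c *\<^sub>R x - (orth_proj L z - c *\<^sub>R orth_proj L 0 + c *\<^sub>R orth_proj L x)
    = (z - orth_proj L z) + c *\<^sub>R (x - orth_proj L x) - c *\<^sub>R (0 - orth_proj L 0)"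
    by (simp add: algebra_simps)
  ultimately show "orthogonal
      (z + c *\<^sub>R x - (orth_proj L z - c *\<^sub>R orth_proj L 0 + c *\<^sub>R orth_proj L x)) (u - v)"
    by (simp only: orthogonal_def inner_add_left inner_diff_left inner_scaleR_left)
qed

lemma homothetic_orth_proj:
  assumes "plane m L" "homothetic K1 K2"
  shows "homothetic (orth_proj L ` K1) (orth_proj L ` K2)"
proof -
  obtain z c where "c \<noteq> 0" and K1: "K1 = (\<lambda>x. z + c *\<^sub>R x) ` K2"
    using assms(2) unfolding homothetic_def by blast
  have "orth_proj L ` K1 =
    (\<lambda>x. (orth_proj L z - c *\<^sub>R orth_proj L 0) + c *\<^sub>R x) ` orth_proj L ` K2"
    unfolding K1 image_image orth_proj_affine_comb[OF assms(1)] ..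
  with \<open>c \<noteq> 0\<close> show ?thesis
    unfolding homothetic_def by blast
qed

lemma plane_subspace: "subspace S \<Longrightarrow> plane (dim S) S"
  unfolding plane_def by (rule exI[of _ 0]) auto

lemma inner_orth_proj_subspace:
  assumes "subspace S" "u \<in> S"
  shows "u \<bullet> orth_proj S x = u \<bullet> x"
proof -
  have "(x - orth_proj S x) \<bullet> u = 0"
    using orth_proj_foot(2)[OF plane_subspace[OF assms(1)] assms(2) subspace_0[OF assms(1)], of x]
    by (simp add: orthogonal_def)
  then have "u \<bullet> (x - orth_proj S x) = 0"
    by (subst inner_commute)
  then show ?thesis
    unfolding inner_diff_right by simp
qed

lemma orth_proj_subspace_id:
  assumes "subspace S" "u \<in> S"
  shows "orth_proj S u = u"
  by (rule orth_proj_eqI[OF plane_subspace[OF assms(1)] assms(2)]) (simp add: orthogonal_def)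

lemma linear_orth_proj:
  assumes "subspace S"
  shows "linear (orth_proj S)"
proof -
  have 0: "orth_proj S 0 = 0"
    by (rule orth_proj_subspace_id[OF assms subspace_0[OF assms]])
  have *: "orth_proj S (z + c *\<^sub>R x) = orth_proj S z + c *\<^sub>R orth_proj S x" for z c x
    using orth_proj_affine_comb[OF plane_subspace[OF assms], of z c x] by (simp add: 0)
  show ?thesis
    using *[of _ 1] *[of 0] by (intro linearI) (simp_all add: 0)
qed

section \<open>Barrier cones and support functions\<close>

definition barrier_cone :: "'a::euclidean_space set \<Rightarrow> 'a set" where
  "barrier_cone K = {u. bdd_above ((\<bullet>) u ` K)}"

definition support_fun :: "'a::euclidean_space set \<Rightarrow> 'a \<Rightarrow> real" where
  "support_fun K u = (SUP x\<in>K. u \<bullet> x)"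

text \<open>On the directions in \<open>S\<close>, the support functions behave as if \<open>K1 = z + c K2\<close> with \<open>c > 0\<close>.
  The relation allows positive ratios only; a negative ratio is expressed by reflecting \<open>K2\<close>.
  Since \<^const>\<open>support_fun\<close> is real-valued, the barrier cones (the directions in which the support
  function is finite) have to be compared separately.\<close>
definition support_match :: "'a::euclidean_space set \<Rightarrow> 'a set \<Rightarrow> 'a set \<Rightarrow> bool" where
  "support_match S K1 K2 \<longleftrightarrow> (\<exists>z c. c > 0 \<and>
     (\<forall>u\<in>S. (u \<in> barrier_cone K1 \<longleftrightarrow> u \<in> barrier_cone K2) \<and>
       (u \<in> barrier_cone K1 \<longrightarrow> support_fun K1 u = u \<bullet> z + c * support_fun K2 u)))"

lemma support_match_mono:
  assumes "support_match S K1 K2" "T \<subseteq> S"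
  shows "support_match T K1 K2"
proof -
  obtain z c where "c > 0" and *:
    "\<forall>u\<in>S. (u \<in> barrier_cone K1 \<longleftrightarrow> u \<in> barrier_cone K2) \<and>
       (u \<in> barrier_cone K1 \<longrightarrow> support_fun K1 u = u \<bullet> z + c * support_fun K2 u)"
    using assms(1) unfolding support_match_def by blast
  have "\<forall>u\<in>T. (u \<in> barrier_cone K1 \<longleftrightarrow> u \<in> barrier_cone K2) \<and>
       (u \<in> barrier_cone K1 \<longrightarrow> support_fun K1 u = u \<bullet> z + c * support_fun K2 u)"
    using * assms(2) by (meson subsetD)
  with \<open>c > 0\<close> show ?thesis
    unfolding support_match_def by blast
qed

lemma barrier_cone_neg: "u \<in> barrier_cone (uminus ` K) \<longleftrightarrow> - u \<in> barrier_cone K"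
  by (simp add: barrier_cone_def image_image)

lemma support_fun_neg: "support_fun (uminus ` K) u = support_fun K (- u)"
  by (simp add: support_fun_def image_image)

lemma inner_le_support_fun: "u \<in> barrier_cone K \<Longrightarrow> x \<in> K \<Longrightarrow> u \<bullet> x \<le> support_fun K u"
  unfolding barrier_cone_def support_fun_def by (simp add: cSUP_upper)

lemma support_fun_le: "K \<noteq> {} \<Longrightarrow> (\<And>x. x \<in> K \<Longrightarrow> u \<bullet> x \<le> b) \<Longrightarrow> support_fun K u \<le> b"
  unfolding support_fun_def by (rule cSUP_least)

text \<open>The functional \<open>u\<close> sees \<open>K1\<close> only through the set of its values there; if these values are
  obtained from those of \<open>v\<close> on \<open>K2\<close> by an increasing affine map of the line, then so are
  boundedness and supremum.\<close>
lemma support_affine_image: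
  assumes "K2 \<noteq> {}" "c > 0" and eq: "(\<bullet>) u ` K1 = (\<lambda>x. a + c * (v \<bullet> x)) ` K2"
  shows "u \<in> barrier_cone K1 \<longleftrightarrow> v \<in> barrier_cone K2"
    and "u \<in> barrier_cone K1 \<Longrightarrow> support_fun K1 u = a + c * support_fun K2 v"
proof -
  have K1: "K1 \<noteq> {}"
    using eq assms(1) by auto
  have fw: "\<exists>y\<in>K2. u \<bullet> x = a + c * (v \<bullet> y)" if "x \<in> K1" for x
    using that eq by blast
  have bw: "\<exists>x\<in>K1. u \<bullet> x = a + c * (v \<bullet> y)" if "y \<in> K2" for y
    using that eq by (metis (no_types, lifting) imageE imageI)
  have up1: "v \<bullet> y \<le> (M - a) / c" if "\<forall>x\<in>K1. u \<bullet> x \<le> M" "y \<in> K2" for y M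
    using bw[OF that(2)] that(1) assms(2) by (force simp: field_simps)
  have up2: "u \<bullet> x \<le> a + c * M" if "\<forall>y\<in>K2. v \<bullet> y \<le> M" "x \<in> K1" for x M
    using fw[OF that(2)] that(1) assms(2) by (force simp: field_simps)
  show iff: "u \<in> barrier_cone K1 \<longleftrightarrow> v \<in> barrier_cone K2"
  proof
    assume "u \<in> barrier_cone K1"
    then show "v \<in> barrier_cone K2"
      using up1[of "support_fun K1 u"] inner_le_support_fun[of u K1]
      unfolding barrier_cone_def mem_Collect_eq
      by (intro bdd_aboveI2[of K2 _ "(support_fun K1 u - a) / c"]) blast
  next
    assume "v \<in> barrier_cone K2"
    then show "u \<in> barrier_cone K1"
      using up2[of "support_fun K2 v"] inner_le_support_fun[of v K2]
      unfolding barrier_cone_def mem_Collect_eq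
      by (intro bdd_aboveI2[of K1 _ "a + c * support_fun K2 v"]) blast
  qed
  assume u: "u \<in> barrier_cone K1"
  then have v: "v \<in> barrier_cone K2"
    using iff by blast
  have "support_fun K1 u \<le> a + c * support_fun K2 v"
    using K1 up2 inner_le_support_fun[OF v] by (intro support_fun_le) auto
  moreover have "support_fun K2 v \<le> (support_fun K1 u - a) / c"
    using assms(1) up1 inner_le_support_fun[OF u] by (intro support_fun_le) auto
  ultimately show "support_fun K1 u = a + c * support_fun K2 v"
    using assms(2) by (simp add: field_simps)
qed

lemma barrier_cone_0 [simp]: "0 \<in> barrier_cone K"
  unfolding barrier_cone_def mem_Collect_eq by (rule bdd_aboveI2[of _ _ 0]) simp

lemma barrier_cone_add:
  assumes "u \<in> barrier_cone K" "v \<in> barrier_cone K"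
  shows "u + v \<in> barrier_cone K"
  unfolding barrier_cone_def mem_Collect_eq
proof (rule bdd_aboveI2)
  show "(u + v) \<bullet> x \<le> support_fun K u + support_fun K v" if "x \<in> K" for x
    unfolding inner_add_left using assms that by (intro add_mono inner_le_support_fun)
qed

lemma support_fun_add_le:
  assumes "K \<noteq> {}" "u \<in> barrier_cone K" "v \<in> barrier_cone K"
  shows "support_fun K (u + v) \<le> support_fun K u + support_fun K v"
proof (rule support_fun_le[OF assms(1)])
  show "(u + v) \<bullet> x \<le> support_fun K u + support_fun K v" if "x \<in> K" for x
    unfolding inner_add_left using assms that by (intro add_mono inner_le_support_fun)
qed

lemma support_fun_0: "K \<noteq> {} \<Longrightarrow> support_fun K 0 = 0"
  by (simp add: support_fun_def image_constant_conv)

lemma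
  assumes "K \<noteq> {}" "u \<in> barrier_cone K" "(t::real) \<ge> 0"
  shows barrier_cone_scaleR: "t *\<^sub>R u \<in> barrier_cone K"
    and support_fun_scaleR: "support_fun K (t *\<^sub>R u) = t * support_fun K u"
proof -
  have "t *\<^sub>R u \<in> barrier_cone K \<and> support_fun K (t *\<^sub>R u) = t * support_fun K u"
  proof (cases "t = 0")
    case True
    then show ?thesis
      using assms(1) by (simp add: support_fun_0)
  next
    case False
    with assms(3) have "t > 0" by simp
    have "(\<bullet>) (t *\<^sub>R u) ` K = (\<lambda>x. 0 + t * (u \<bullet> x)) ` K"
      by simp
    from support_affine_image[OF assms(1) \<open>t > 0\<close> this] show ?thesis
      using assms(2) by simp
  qed
  then show "t *\<^sub>R u \<in> barrier_cone K" "support_fun K (t *\<^sub>R u) = t * support_fun K u"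
    by blast+
qed

text \<open>A direction \<open>u\<close> in \<open>S\<close> takes the same value at a point and at its projection on \<open>S\<close>. A
  homothety between the projections therefore relates the values of \<open>u\<close> on the sets themselves,
  and the sign of the ratio decides which of the two alternatives holds.\<close>
lemma support_match_of_homothetic_orth_proj:
  assumes "subspace S" "K2 \<noteq> {}" "homothetic (orth_proj S ` K1) (orth_proj S ` K2)"
  shows "support_match S K1 K2 \<or> support_match S K1 (uminus ` K2)"
proof -
  obtain z c where "c \<noteq> 0"
    and eq: "orth_proj S ` K1 = (\<lambda>x. z + c *\<^sub>R x) ` orth_proj S ` K2"
    using assms(3) unfolding homothetic_def by blast
  have *: "(\<bullet>) u ` K1 = (\<lambda>x. u \<bullet> z + c * (u \<bullet> x)) ` K2" if "u \<in> S" for u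
  proof -
    have "(\<bullet>) u ` K1 = (\<bullet>) u ` orth_proj S ` K1"
      by (simp add: image_image inner_orth_proj_subspace[OF assms(1) that])
    also have "\<dots> = (\<lambda>x. u \<bullet> z + c * (u \<bullet> x)) ` K2"
      unfolding eq by (simp add: image_image inner_add_right
          inner_orth_proj_subspace[OF assms(1) that])
    finally show ?thesis .
  qed
  consider "c > 0" | "- c > 0"
    using \<open>c \<noteq> 0\<close> by linarith
  then show ?thesis
  proof cases
    case 1
    have "support_match S K1 K2"
      unfolding support_match_def
      using support_affine_image[OF assms(2) 1 *] 1 by blast
    then show ?thesis ..
  next
    case 2
    have "(\<bullet>) u ` K1 = (\<lambda>x. u \<bullet> z + (- c) * (u \<bullet> x)) ` uminus ` K2" if "u \<in> S" for u
      using *[OF that] by (simp add: image_image)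
    from support_affine_image[OF _ 2 this] have "support_match S K1 (uminus ` K2)"
      unfolding support_match_def using 2 assms(2) by blast
    then show ?thesis ..
  qed
qed

text \<open>A closed convex set is the intersection of its supporting half-spaces: a hyperplane that
  strictly separates \<open>x\<close> from \<open>K\<close> has a normal direction in the barrier cone.\<close>
lemma mem_closed_convex_iff_support:
  assumes "closed K" "convex K"  "K \<noteq> {}"
  shows "x \<in> K \<longleftrightarrow> (\<forall>u\<in>barrier_cone K. u \<bullet> x \<le> support_fun K u)"
proof
  assume *: "\<forall>u\<in>barrier_cone K. u \<bullet> x \<le> support_fun K u"
  show "x \<in> K"
  proof (rule ccontr)
    assume "x \<notin> K"
    then obtain a b where ab: "a \<bullet> x < b" "\<forall>y\<in>K. a \<bullet> y > b"
      using separating_hyperplane_closed_point[OF assms(2,1)] by blast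
    have "- a \<in> barrier_cone K"
      unfolding barrier_cone_def using ab(2)
      by (auto intro!: bdd_aboveI2[of _ _ "- b"] less_imp_le)
    with * have "- a \<bullet> x \<le> support_fun K (- a)" by blast
    moreover have "support_fun K (- a) \<le> - b"
      using ab(2) by (intro support_fun_le[OF assms(3)]) (auto intro: less_imp_le)
    ultimately show False
      using ab(1) by simp
  qed
qed (simp add: inner_le_support_fun)

lemma homothetic_of_support_match_UNIV:
  assumes "closed K1" "convex K1" "K1 \<noteq> {}" "closed K2" "convex K2" "K2 \<noteq> {}"
    and "support_match UNIV K1 K2"
  shows "homothetic K1 K2"
proof -
  obtain z c where c: "c > 0" and B: "\<And>u. u \<in> barrier_cone K1 \<longleftrightarrow> u \<in> barrier_cone K2"
    and h: "\<And>u. u \<in> barrier_cone K2 \<Longrightarrow> support_fun K1 u = u \<bullet> z + c * support_fun K2 u"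
    using assms(7) unfolding support_match_def by blast
  have *: "x \<in> K1 \<longleftrightarrow> (1 / c) *\<^sub>R (x - z) \<in> K2" for x
  proof -
    have "u \<bullet> x \<le> u \<bullet> z + c * support_fun K2 u \<longleftrightarrow>
        u \<bullet> ((1 / c) *\<^sub>R (x - z)) \<le> support_fun K2 u" for u
      using c by (simp add: field_simps inner_diff_right)
    then show ?thesis
      unfolding mem_closed_convex_iff_support[OF assms(1-3)]
        mem_closed_convex_iff_support[OF assms(4-6)] using B h by auto
  qed
  have "K1 = (\<lambda>x. z + c *\<^sub>R x) ` K2"
  proof (intro equalityI subsetI)
    fix x assume "x \<in> K1"
    then show "x \<in> (\<lambda>x. z + c *\<^sub>R x) ` K2"
      using * c by (intro image_eqI[of _ _ "(1 / c) *\<^sub>R (x - z)"]) auto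
  next
    fix x assume "x \<in> (\<lambda>x. z + c *\<^sub>R x) ` K2"
    then obtain y where "y \<in> K2" "x = z + c *\<^sub>R y"
      by blast
    with * c show "x \<in> K1"
      by simp
  qed
  moreover have "c \<noteq> 0"
    using c by simp
  ultimately show ?thesis
    unfolding homothetic_def by blast
qed

lemma homothetic_uminus: "homothetic K1 (uminus ` K2) \<Longrightarrow> homothetic K1 K2"
proof -
  assume "homothetic K1 (uminus ` K2)"
  then obtain z c where "c \<noteq> 0" "K1 = (\<lambda>x. z + c *\<^sub>R x) ` uminus ` K2"
    unfolding homothetic_def by blast
  then have "- c \<noteq> 0" "K1 = (\<lambda>x. z + (- c) *\<^sub>R x) ` K2"
    by (simp_all add: image_image)
  then show ?thesis
    unfolding homothetic_def by blast
qed

section \<open>Linear functionals from additivity on cones\<close>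

text \<open>Take a basis of the span of \<open>B\<close> inside \<open>B\<close> and extend \<open>f\<close> linearly from it. A vector \<open>u\<close> of
  \<open>B\<close> may have negative coordinates, so these are moved to the other side: \<open>u\<close> plus one
  nonnegative combination equals another one, and \<open>f\<close> can be evaluated on both sides.\<close>
lemma additive_on_cone_imp_inner:
  fixes f :: "'a::euclidean_space \<Rightarrow> real"
  assumes zero: "0 \<in> B"
    and add: "\<And>u v. u \<in> B \<Longrightarrow> v \<in> B \<Longrightarrow> u + v \<in> B"
    and scale: "\<And>t u. t \<ge> 0 \<Longrightarrow> u \<in> B \<Longrightarrow> t *\<^sub>R u \<in> B"
    and fadd: "\<And>u v. u \<in> B \<Longrightarrow> v \<in> B \<Longrightarrow> f (u + v) = f u + f v"
    and fscale: "\<And>t u. t \<ge> 0 \<Longrightarrow> u \<in> B \<Longrightarrow> f (t *\<^sub>R u) = t * f u"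
  obtains z where "\<And>u. u \<in> B \<Longrightarrow> f u = u \<bullet> z"
proof -
  have f0: "f 0 = 0"
    using fscale[of 0 0] zero by simp
  have comb: "(\<Sum>c\<in>C. a c *\<^sub>R c) \<in> B \<and> f (\<Sum>c\<in>C. a c *\<^sub>R c) = (\<Sum>c\<in>C. a c * f c)"
    if "finite C" "C \<subseteq> B" "\<And>c. a c \<ge> 0" for C and a :: "'a \<Rightarrow> real"
    using that(1,2)
  proof induction
    case (insert x F)
    then have "x \<in> B" "a x *\<^sub>R x \<in> B"
      using that(3)[of x] scale by simp_all
    with insert that(3)[of x] show ?case
      by (simp add: add fadd fscale)
  qed (simp add: zero f0)
  obtain C where C: "C \<subseteq> B" "independent C" "B \<subseteq> span C"
    using maximal_independent_subset by blast
  have "finite C"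
    using C(2) independent_imp_finite by blast
  obtain g where g: "linear g" "\<And>x. x \<in> C \<Longrightarrow> g x = f x"
    using linear_independent_extend[OF C(2), of f] by blast
  have gf: "g u = f u" if u: "u \<in> B" for u
  proof -
    obtain a where a: "u = (\<Sum>c\<in>C. a c *\<^sub>R c)"
      using u C(3) unfolding span_finite[OF \<open>finite C\<close>] by blast
    define p n where "p c = max (a c) 0" and "n c = max (- a c) 0" for c
    have pn: "a c = p c - n c" "p c \<ge> 0" "n c \<ge> 0" for c
      unfolding p_def n_def by auto
    have eq: "u + (\<Sum>c\<in>C. n c *\<^sub>R c) = (\<Sum>c\<in>C. p c *\<^sub>R c)"
      unfolding a pn(1) by (simp add: sum.distrib[symmetric] algebra_simps)
    have "f u + (\<Sum>c\<in>C. n c * f c) = (\<Sum>c\<in>C. p c * f c)"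
      using fadd[OF u, of "\<Sum>c\<in>C. n c *\<^sub>R c"] comb[OF \<open>finite C\<close> C(1), of n]
        comb[OF \<open>finite C\<close> C(1), of p] pn(2,3) unfolding eq by simp
    then have "f u = (\<Sum>c\<in>C. a c * f c)"
      unfolding pn(1) by (simp add: left_diff_distrib sum_subtractf)
    also have "\<dots> = g u"
      unfolding a using g by (simp add: linear_sum linear_scale)
    finally show ?thesis by simp
  qed
  \<comment> \<open>The adjoint of a functional, applied to \<open>1\<close>, is the vector that represents it.\<close>
  have "f u = u \<bullet> adjoint g 1" if "u \<in> B" for u
    using gf[OF that] adjoint_works[OF g(1), of u 1] by simp
  then show ?thesis
    using that by blast
qed


text \<open>By continuity \<open>f\<close> fails to be additive at all pairs near \<open>(a, b)\<close>, so \<open>g\<close> is linear on the cone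
  spanned by each such pair. Hence \<open>g (p + q) = g p + g q\<close> for \<open>p\<close> in the cone \<open>C a\<close> over a small
  ball around \<open>a\<close> and \<open>q\<close> in the corresponding cone \<open>C b\<close>. The cone \<open>C b\<close> absorbs every vector
  after adding a large multiple of \<open>b\<close>; expanding \<open>g (p + p' + M b)\<close> in two ways then makes \<open>g\<close>
  additive within \<open>C a\<close>, so it is a linear functional there. The same functional is then forced
  on \<open>C b\<close> and near \<open>a + b\<close>.\<close>
lemma inner_near_nonadditive_pair:
  fixes f g :: "'a::euclidean_space \<Rightarrow> real"
  assumes contf: "continuous_on UNIV f"
    and scale: "\<And>t u. t \<ge> 0 \<Longrightarrow> g (t *\<^sub>R u) = t * g u"
    and dich: "\<And>u v. (\<forall>s\<ge>0. \<forall>t\<ge>0. f (s *\<^sub>R u + t *\<^sub>R v) = s * f u + t * f v) \<or>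
      (\<forall>s\<ge>0. \<forall>t\<ge>0. g (s *\<^sub>R u + t *\<^sub>R v) = s * g u + t * g v)"
    and nonadd: "f (a + b) \<noteq> f a + f b"
  obtains z e where "e > 0"
    "\<And>r x. r \<in> {a, b, a + b} \<Longrightarrow> x \<in> ball r e \<Longrightarrow> g x = x \<bullet> z"
proof -
  have contf': "continuous_on UNIV (\<lambda>p. f (h p))" if "continuous_on UNIV h" for h :: "'a \<times> 'a \<Rightarrow> 'a"
    using continuous_on_compose2[OF contf that] by simp
  have "open {p. f (fst p + snd p) \<noteq> f (fst p) + f (snd p)}"
    by (intro open_Collect_neq continuous_on_add contf' continuous_on_fst continuous_on_snd
        continuous_on_id)
  moreover have "(a, b) \<in> {p. f (fst p + snd p) \<noteq> f (fst p) + f (snd p)}"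
    using nonadd by simp
  ultimately obtain A B where AB: "open A" "open B" "(a, b) \<in> A \<times> B"
    "A \<times> B \<subseteq> {p. f (fst p + snd p) \<noteq> f (fst p) + f (snd p)}"
    by (rule open_prod_elim)
  obtain e1 where e1: "e1 > 0" "ball a e1 \<subseteq> A"
    using AB(1,3) open_contains_ball by (metis mem_Sigma_iff)
  obtain e2 where e2: "e2 > 0" "ball b e2 \<subseteq> B"
    using AB(2,3) open_contains_ball by (metis mem_Sigma_iff)
  define e where "e = min e1 e2"
  have e: "e > 0" "ball a e \<subseteq> A" "ball b e \<subseteq> B"
    using e1 e2 by (auto simp: e_def)
  have fne: "f (p + q) \<noteq> f p + f q" if "p \<in> ball a e" "q \<in> ball b e" for p q
  proof -
    have "(p, q) \<in> A \<times> B"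
      using that e(2,3) by blast
    then show ?thesis
      using AB(4) by auto
  qed
  have pair: "g (s *\<^sub>R p + t *\<^sub>R q) = s * g p + t * g q"
    if "p \<in> ball a e" "q \<in> ball b e" "s \<ge> 0" "t \<ge> 0" for p q s t
  proof -
    have "\<not> (\<forall>s\<ge>0. \<forall>t\<ge>0. f (s *\<^sub>R p + t *\<^sub>R q) = s * f p + t * f q)"
    proof
      assume "\<forall>s\<ge>0. \<forall>t\<ge>0. f (s *\<^sub>R p + t *\<^sub>R q) = s * f p + t * f q"
      from this[rule_format, of 1 1] show False
        using fne[OF that(1,2)] by simp
    qed
    then show ?thesis
      using dich[of p q] that(3,4) by blast
  qed
  define C where "C r = conic hull (ball r e)" for r :: 'a
  have CI: "s *\<^sub>R y \<in> C r" if "s \<ge> 0" "y \<in> ball r e" for s y r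
    using that unfolding C_def conic_hull_explicit by blast
  have CE: "\<exists>s y. s \<ge> 0 \<and> y \<in> ball r e \<and> p = s *\<^sub>R y" if "p \<in> C r" for p r
    using that unfolding C_def conic_hull_explicit by blast
  have ballC: "x \<in> C r" if "x \<in> ball r e" for x r
    using CI[of 1 x r] that by simp
  have C0: "0 \<in> C r" for r
    using CI[of 0 r r] e(1) by simp
  have Cscale: "t *\<^sub>R p \<in> C r" if "t \<ge> 0" "p \<in> C r" for t p r
    using that unfolding C_def by (metis conic_conic_hull conic_def)
  have Cadd: "p + q \<in> C r" if "p \<in> C r" "q \<in> C r" for p q r
  proof -
    have "convex_cone (C r)"
      unfolding convex_cone_def
    proof (intro conjI)
      show "C r \<noteq> {}"
        using C0[of r] by blast
    qed (simp_all add: C_def convex_conic_hull conic_conic_hull)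
    then show ?thesis
      using that by (rule convex_cone_add)
  qed
  have cross: "g (p + q) = g p + g q" if p: "p \<in> C a" and q: "q \<in> C b" for p q
  proof -
    obtain s p' t q' where "s \<ge> 0" "p' \<in> ball a e" "p = s *\<^sub>R p'"
      "t \<ge> 0" "q' \<in> ball b e" "q = t *\<^sub>R q'"
      using CE[OF p] CE[OF q] by blast
    then show ?thesis
      using pair[of p' q' s t] by (simp add: scale)
  qed
  have shift: "\<exists>M>0. M *\<^sub>R r + p \<in> C r" for p r
  proof -
    define M where "M = norm p / e + 1"
    have "M > 0"
      using e(1) by (simp add: M_def add_nonneg_pos)
    have "norm p < M * e"
      using e(1) by (simp add: M_def field_simps)
    then have "norm ((1 / M) *\<^sub>R p) < e"
      using \<open>M > 0\<close> by (simp add: field_simps)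
    then have "r + (1 / M) *\<^sub>R p \<in> ball r e"
      by (simp add: dist_norm)
    from CI[OF _ this, of M] \<open>M > 0\<close> have "M *\<^sub>R r + p \<in> C r"
      by (simp add: scaleR_add_right)
    then show ?thesis
      using \<open>M > 0\<close> by blast
  qed
  have center: "r \<in> C r" for r
    using ballC[of r r] e(1) by simp
  have addCa: "g (p + p') = g p + g p'" if p: "p \<in> C a" and p': "p' \<in> C a" for p p'
  proof -
    obtain M where M: "M > 0" "M *\<^sub>R b + p' \<in> C b"
      using shift by blast
    have Mb: "M *\<^sub>R b \<in> C b"
      using Cscale[of M b b] center[of b] M(1) by simp
    have "g (p + p') + g (M *\<^sub>R b) = g (p + (M *\<^sub>R b + p'))"
      using cross[OF Cadd[OF p p'] Mb] by (simp add: algebra_simps)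
    also have "\<dots> = g p + g (p' + M *\<^sub>R b)"
      using cross[OF p M(2)] by (simp add: algebra_simps)
    also have "\<dots> = g p + (g p' + g (M *\<^sub>R b))"
      using cross[OF p' Mb] by simp
    finally show ?thesis by simp
  qed
  obtain z where z: "\<And>p. p \<in> C a \<Longrightarrow> g p = p \<bullet> z"
  proof (rule additive_on_cone_imp_inner[of "C a" g])
    fix z assume "\<And>u. u \<in> C a \<Longrightarrow> g u = u \<bullet> z"
    then show thesis
      by (rule that)
  qed (rule C0 Cadd Cscale addCa scale; assumption)+
  have zb: "g q = q \<bullet> z" if "q \<in> C b" for q
  proof -
    obtain M where M: "M > 0" "M *\<^sub>R a + q \<in> C a"
      using shift by blast
    have Ma: "M *\<^sub>R a \<in> C a"
      using Cscale[of M a a] center[of a] M(1) by simp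
    show ?thesis
      using cross[OF Ma that] z[OF M(2)] z[OF Ma] by (simp add: inner_add_left)
  qed
  have zab: "g x = x \<bullet> z" if "x \<in> ball (a + b) e" for x
  proof -
    have "x - a \<in> C b"
      using that by (intro ballC) (simp add: dist_norm algebra_simps)
    then show ?thesis
      using cross[OF center, of "x - a"] z[OF center] zb[of "x - a"]
      by (simp add: inner_diff_left)
  qed
  show ?thesis
    using that[OF e(1), of z] z zb zab ballC by blast
qed

text \<open>If on each two-dimensional cone one of \<open>f\<close>, \<open>g\<close> is linear, the choice cannot switch between
  cones. Suppose \<open>f\<close> is not additive at \<open>(a, b)\<close> and \<open>g\<close> is not additive at \<open>(c, d)\<close>. Then \<open>g\<close> is a
  linear functional \<open>z\<close> near \<open>a\<close>, \<open>b\<close>, \<open>a + b\<close>, while \<open>f\<close> differs from any given linear functional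
  at one of these points; and symmetrically with \<open>c\<close>, \<open>d\<close>. So there are \<open>r\<close> and \<open>q\<close> such that \<open>g\<close>
  equals \<open>z\<close> near \<open>r\<close> but not at \<open>q\<close>, and \<open>f\<close> equals \<open>w\<close> near \<open>q\<close> but not at \<open>r\<close>. Neither function is
  linear on the cone spanned by \<open>r\<close> and \<open>q\<close>.\<close>
lemma additive_dichotomy:
  fixes f g :: "'a::euclidean_space \<Rightarrow> real"
  assumes contf: "continuous_on UNIV f" and contg: "continuous_on UNIV g"
    and scalef: "\<And>t u. t \<ge> 0 \<Longrightarrow> f (t *\<^sub>R u) = t * f u"
    and scaleg: "\<And>t u. t \<ge> 0 \<Longrightarrow> g (t *\<^sub>R u) = t * g u"
    and dich: "\<And>u v. (\<forall>s\<ge>0. \<forall>t\<ge>0. f (s *\<^sub>R u + t *\<^sub>R v) = s * f u + t * f v) \<or>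
      (\<forall>s\<ge>0. \<forall>t\<ge>0. g (s *\<^sub>R u + t *\<^sub>R v) = s * g u + t * g v)"
  shows "(\<forall>u v. f (u + v) = f u + f v) \<or> (\<forall>u v. g (u + v) = g u + g v)"
proof (rule ccontr)
  assume "\<not> ?thesis"
  then obtain a b c d where ab: "f (a + b) \<noteq> f a + f b" and cd: "g (c + d) \<noteq> g c + g d"
    by blast
  have dich': "(\<forall>s\<ge>0. \<forall>t\<ge>0. g (s *\<^sub>R u + t *\<^sub>R v) = s * g u + t * g v) \<or>
      (\<forall>s\<ge>0. \<forall>t\<ge>0. f (s *\<^sub>R u + t *\<^sub>R v) = s * f u + t * f v)" for u v
    using dich[of u v] by blast
  obtain z e where e: "e > 0"
    and z: "\<And>r x. r \<in> {a, b, a + b} \<Longrightarrow> x \<in> ball r e \<Longrightarrow> g x = x \<bullet> z"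
    by (rule inner_near_nonadditive_pair[OF contf scaleg dich ab]) blast+
  obtain w e' where e': "e' > 0"
    and w: "\<And>r x. r \<in> {c, d, c + d} \<Longrightarrow> x \<in> ball r e' \<Longrightarrow> f x = x \<bullet> w"
    by (rule inner_near_nonadditive_pair[OF contg scalef dich' cd]) blast+
  have "\<exists>r\<in>{a, b, a + b}. f r \<noteq> r \<bullet> w"
    using ab by (auto simp: inner_add_left)
  then obtain r where r: "r \<in> {a, b, a + b}" "f r \<noteq> r \<bullet> w"
    by blast
  have "\<exists>q\<in>{c, d, c + d}. g q \<noteq> q \<bullet> z"
    using cd by (auto simp: inner_add_left)
  then obtain q where q: "q \<in> {c, d, c + d}" "g q \<noteq> q \<bullet> z"
    by blast
  have small: "\<exists>t>0. p + t *\<^sub>R p' \<in> ball p \<epsilon>" if "\<epsilon> > 0" for p p' :: 'a and \<epsilon> :: real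
  proof -
    have pos: "norm p' + 1 > 0"
      by (simp add: add_nonneg_pos)
    have "\<epsilon> * norm p' < \<epsilon> * (norm p' + 1)"
      using that by simp
    then have "(\<epsilon> / (norm p' + 1)) * norm p' < \<epsilon>"
      using pos by (simp add: pos_divide_less_eq)
    then show ?thesis
      using that by (intro exI[of _ "\<epsilon> / (norm p' + 1)"]) (simp add: dist_norm add_nonneg_pos)
  qed
  show False
    using dich[of r q]
  proof
    assume lin: "\<forall>s\<ge>0. \<forall>t\<ge>0. f (s *\<^sub>R r + t *\<^sub>R q) = s * f r + t * f q"
    obtain t where t: "t > 0" "q + t *\<^sub>R r \<in> ball q e'"
      using small[OF e'] by blast
    have "(q + t *\<^sub>R r) \<bullet> w = t * f r + f q"
      using lin[rule_format, of t 1] w[OF q(1) t(2)] t(1) by (simp add: add.commute)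
    moreover have "f q = q \<bullet> w"
      using w[OF q(1), of q] e' by simp
    ultimately show False
      using r(2) t(1) by (simp add: inner_add_left)
  next
    assume lin: "\<forall>s\<ge>0. \<forall>t\<ge>0. g (s *\<^sub>R r + t *\<^sub>R q) = s * g r + t * g q"
    obtain t where t: "t > 0" "r + t *\<^sub>R q \<in> ball r e"
      using small[OF e] by blast
    have "(r + t *\<^sub>R q) \<bullet> z = g r + t * g q"
      using lin[rule_format, of 1 t] z[OF r(1) t(2)] t(1) by simp
    moreover have "g r = r \<bullet> z"
      using z[OF r(1), of r] e by simp
    ultimately show False
      using q(2) t(1) by (simp add: inner_add_left)
  qed
qed

section \<open>Proportional additivity defects\<close>

text \<open>The ratio \<open>d1 / d2\<close> of the additivity defects is constant on triples that contain a vector of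
  \<open>N\<close>, and it has to be shown that two pairs with nonzero \<open>d2\<close> have the same ratio even if they
  span four dimensions. Fix \<open>(u, v)\<close> with \<open>u\<close> in \<open>N\<close>, and let \<open>(p, q)\<close> be another such pair. If a
  mixed defect between \<open>u\<close> or \<open>u + v\<close> and \<open>p\<close>, \<open>q\<close> or \<open>p + q\<close> is nonzero, that mixed pair
  shares a triple with each of the two. If all these mixed defects vanish, then replacing \<open>u\<close> by
  \<open>u + p\<close> in \<open>(u, v)\<close> and \<open>p\<close> by \<open>u + p\<close> in \<open>(p, q)\<close> does not change the defects, and the new
  pairs lie in the common triple \<open>(u + p, v, q)\<close>.

  In the application \<open>N\<close> consists of the vectors of a convex cone \<open>B\<close> whose negatives are not in
  \<open>B\<close>.\<close>
lemma common_defect_ratio: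
  fixes h1 h2 :: "'a::real_vector \<Rightarrow> real"
  defines "d1 \<equiv> \<lambda>p q. h1 p + h1 q - h1 (p + q)"
    and "d2 \<equiv> \<lambda>p q. h2 p + h2 q - h2 (p + q)"
  assumes Badd: "\<And>u v. u \<in> B \<Longrightarrow> v \<in> B \<Longrightarrow> u + v \<in> B"
    and NB: "N \<subseteq> B" "x \<in> N"
    and Nadd: "\<And>u v. u \<in> N \<Longrightarrow> v \<in> B \<Longrightarrow> u + v \<in> N"
    and triple: "\<And>u v w. u \<in> N \<Longrightarrow> v \<in> B \<Longrightarrow> w \<in> B \<Longrightarrow>
      \<exists>c>0. \<forall>p\<in>B \<inter> span {u, v, w}. \<forall>q\<in>B \<inter> span {u, v, w}. d1 p q = c * d2 p q"
  shows "\<exists>c>0. \<forall>p\<in>B. \<forall>q\<in>B. d1 p q = c * d2 p q"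
proof (cases "\<forall>p\<in>B. \<forall>q\<in>B. d2 p q = 0")
  case True
  have "d1 p q = 1 * d2 p q" if "p \<in> B" "q \<in> B" for p q
  proof -
    obtain c where "\<forall>p'\<in>B \<inter> span {x, p, q}. \<forall>q'\<in>B \<inter> span {x, p, q}. d1 p' q' = c * d2 p' q'"
      using triple[OF NB(2) \<open>p \<in> B\<close> \<open>q \<in> B\<close>] by blast
    then have "d1 p q = c * d2 p q"
      using that by (simp add: span_base)
    then show ?thesis
      using True that by simp
  qed
  then show ?thesis
    by (intro exI[of _ 1]) simp
next
  case False
  obtain u v where u: "u \<in> N" and v: "v \<in> B" and uv: "d2 u v \<noteq> 0"
  proof -
    obtain p q where p: "p \<in> B" and q: "q \<in> B" and pq: "d2 p q \<noteq> 0"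
      using False by blast
    show ?thesis
    \<comment> \<open>Translating \<open>p\<close> by \<open>x\<close> brings it into \<open>N\<close> without changing its defect, unless
      \<open>x\<close> already forms a nonzero pair.\<close>
    proof (cases "d2 x p = 0 \<and> d2 x (p + q) = 0")
      case True
      then have "d2 (x + p) q = d2 p q"
        by (simp add: d2_def add.assoc)
      then show ?thesis
        using that[OF Nadd[OF NB(2) p] q] pq by simp
    next
      case False
      then show ?thesis
        using that[OF NB(2) p] that[OF NB(2) Badd[OF p q]] by blast
    qed
  qed
  obtain c where "c > 0"
    and cuv: "\<forall>p\<in>B \<inter> span {u, v, v}. \<forall>q\<in>B \<inter> span {u, v, v}. d1 p q = c * d2 p q"
    using triple[OF u v v] by blast
  have uB: "u \<in> B"
    using u NB(1) by blast
  have spread: "d1 p q = c * d2 p q"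
    if a: "a \<in> N" "b \<in> B" "b' \<in> B"
      and p0: "p0 \<in> B \<inter> span {a, b, b'}" and q0: "q0 \<in> B \<inter> span {a, b, b'}"
      and known: "d2 p0 q0 \<noteq> 0" "d1 p0 q0 = c * d2 p0 q0"
      and p: "p \<in> B \<inter> span {a, b, b'}" and q: "q \<in> B \<inter> span {a, b, b'}"
    for a b b' p0 q0 p q
  proof -
    obtain c' where c': "\<forall>p\<in>B \<inter> span {a, b, b'}. \<forall>q\<in>B \<inter> span {a, b, b'}. d1 p q = c' * d2 p q"
      using triple[OF a] by blast
    then have "d1 p0 q0 = c' * d2 p0 q0"
      using p0 q0 by blast
    then have "c' = c"
      using known by simp
    then show ?thesis
      using c' p q by blast
  qed
  have base: "d1 u v = c * d2 u v"
    using cuv uB v by (simp add: span_base)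
  have "d1 p q = c * d2 p q" if p: "p \<in> B" and q: "q \<in> B" for p q
  proof (cases "\<exists>x'\<in>{u, u + v}. \<exists>y'\<in>{p, q, p + q}. d2 x' y' \<noteq> 0")
    case True
    then obtain x' y' where x': "x' \<in> {u, u + v}" and y': "y' \<in> {p, q, p + q}"
      and ne: "d2 x' y' \<noteq> 0"
      by blast
    have x'N: "x' \<in> N" and y'B: "y' \<in> B"
      using x' y' u v p q Nadd Badd by auto
    have x'B: "x' \<in> B"
      using x'N NB(1) by blast
    have x's: "x' \<in> span {u, v, y'}"
      using x' by (elim insertE) (simp_all add: span_base span_add)
    have y's: "y' \<in> span {x', p, q}"
      using y' by (elim insertE) (simp_all add: span_base span_add)
    have k: "d1 x' y' = c * d2 x' y'"
      by (rule spread[OF u v y'B _ _ uv base]) (simp_all add: span_base uB v x's x'B y'B)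
    show ?thesis
      by (rule spread[OF x'N p q _ _ ne k]) (simp_all add: span_base p q y's x'B y'B)
  next
    case False
    then have z: "d2 u p = 0" "d2 (u + v) p = 0" "d2 u (p + q) = 0"
      by auto
    have e1: "d2 (u + p) v = d2 u v"
      using z(1,2) by (simp add: d2_def add_ac)
    have e2: "d2 (u + p) q = d2 p q"
      using z(1,3) by (simp add: d2_def add_ac)
    have upN: "u + p \<in> N"
      using u p Nadd by blast
    have upB: "u + p \<in> B"
      using upN NB(1) by blast
    show ?thesis
    proof (cases "d2 p q = 0")
      case True
      obtain c' where "\<forall>p'\<in>B \<inter> span {x, p, q}. \<forall>q'\<in>B \<inter> span {x, p, q}. d1 p' q' = c' * d2 p' q'"
        using triple[OF NB(2) p q] by blast
      then have "d1 p q = c' * d2 p q"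
        using p q by (simp add: span_base)
      with True show ?thesis by simp
    next
      case pq: False
      have k1: "d1 (u + p) v = c * d2 (u + p) v"
        by (rule spread[OF u v p _ _ uv base]) (simp_all add: span_base span_add uB v upB)
      have ne1: "d2 (u + p) v \<noteq> 0"
        using e1 uv by simp
      have k2: "d1 (u + p) q = c * d2 (u + p) q"
        by (rule spread[OF upN v q _ _ ne1 k1]) (simp_all add: span_base upB v q)
      have ne2: "d2 (u + p) q \<noteq> 0"
        using e2 pq by simp
      show ?thesis
        by (rule spread[OF u p q _ _ ne2 k2]) (simp_all add: span_base span_add upB p q)
    qed
  qed
  with \<open>c > 0\<close> show ?thesis by blast
qed


section \<open>Making sign and ratio independent of the subspace\<close>

lemma support_fun_sum_neg_nonneg:
  assumes "K \<noteq> {}" "u \<in> barrier_cone K" "- u \<in> barrier_cone K"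
  shows "0 \<le> support_fun K u + support_fun K (- u)"
  using support_fun_add_le[OF assms] by (simp add: support_fun_0[OF assms(1)])

text \<open>A set whose width vanishes in the directions \<open>u\<close> and \<open>v\<close> also has width \<open>0\<close> in the direction
  \<open>u + v\<close>: subadditivity at \<open>(u, v)\<close> and at \<open>(- u, - v)\<close> leaves no slack.\<close>
lemma support_fun_add_eq_zero_width:
  assumes "K \<noteq> {}" "u \<in> barrier_cone K" "- u \<in> barrier_cone K"
    "v \<in> barrier_cone K" "- v \<in> barrier_cone K"
    and "support_fun K u + support_fun K (- u) = 0" "support_fun K v + support_fun K (- v) = 0"
  shows "support_fun K (u + v) = support_fun K u + support_fun K v"
proof -
  have "- u + - v = - (u + v)"
    by simp
  then have "0 \<le> support_fun K (u + v) + support_fun K (- u + - v)"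
    using support_fun_sum_neg_nonneg[OF assms(1), of "u + v"] barrier_cone_add[OF assms(2,4)]
      barrier_cone_add[OF assms(3,5)] by simp
  then show ?thesis
    using support_fun_add_le[OF assms(1,2,4)] support_fun_add_le[OF assms(1,3,5)] assms(6,7)
    by linarith
qed

lemma continuous_support_fun_orth_proj:
  fixes K B :: "'a::euclidean_space set"
  assumes "K \<noteq> {}" "subspace B" "B \<subseteq> barrier_cone K"
  shows "continuous_on UNIV (\<lambda>u. support_fun K (orth_proj B u))"
proof (rule convex_on_continuous[OF open_UNIV], rule convex_onI)
  fix t :: real and u v :: 'a
  assume t: "0 < t" "t < 1"
  have B: "orth_proj B u \<in> barrier_cone K" for u
    using orth_proj_foot(1)[OF plane_subspace[OF assms(2)]] assms(3) by blast
  have "orth_proj B ((1 - t) *\<^sub>R u + t *\<^sub>R v) = (1 - t) *\<^sub>R orth_proj B u + t *\<^sub>R orth_proj B v"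
    using linear_orth_proj[OF assms(2)] by (simp add: linear_add linear_scale)
  then show "support_fun K (orth_proj B ((1 - t) *\<^sub>R u + t *\<^sub>R v)) \<le>
    (1 - t) * support_fun K (orth_proj B u) + t * support_fun K (orth_proj B v)"
    using support_fun_add_le[OF assms(1), of "(1 - t) *\<^sub>R orth_proj B u" "t *\<^sub>R orth_proj B v"] t
    by (simp add: barrier_cone_scaleR support_fun_scaleR assms(1) B)
qed simp

text \<open>Once the ratio \<open>c\<close> is known, the translation vector comes for free: additivity of the
  difference of support functions on the barrier cone makes it an inner product.\<close>
lemma support_match_UNIV_of_additive:
  assumes K: "K1 \<noteq> {}" "K2 \<noteq> {}" and B: "barrier_cone K1 = barrier_cone K2" and "c > 0"
    and add: "\<And>u v. u \<in> barrier_cone K1 \<Longrightarrow> v \<in> barrier_cone K1 \<Longrightarrow>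
      support_fun K1 (u + v) - c * support_fun K2 (u + v) =
      (support_fun K1 u - c * support_fun K2 u) + (support_fun K1 v - c * support_fun K2 v)"
  shows "support_match UNIV K1 K2"
proof -
  define f where "f u = support_fun K1 u - c * support_fun K2 u" for u
  have scale: "f (t *\<^sub>R u) = t * f u" if "t \<ge> 0" "u \<in> barrier_cone K1" for t u
    using that K B by (simp add: f_def support_fun_scaleR right_diff_distrib)
  obtain z where z: "\<And>u. u \<in> barrier_cone K1 \<Longrightarrow> f u = u \<bullet> z"
  proof (rule additive_on_cone_imp_inner[of "barrier_cone K1" f])
    show "f (u + v) = f u + f v" if "u \<in> barrier_cone K1" "v \<in> barrier_cone K1" for u v
      using add[OF that] by (simp add: f_def)
  next
    fix z assume "\<And>u. u \<in> barrier_cone K1 \<Longrightarrow> f u = u \<bullet> z"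
    then show thesis
      by (rule that)
  qed (use K in \<open>simp_all add: barrier_cone_add barrier_cone_scaleR scale\<close>)
  have "support_fun K1 u = u \<bullet> z + c * support_fun K2 u" if "u \<in> barrier_cone K1" for u
    using z[OF that] by (simp add: f_def)
  then show ?thesis
    unfolding support_match_def using B \<open>c > 0\<close> by blast
qed

lemma dim_span_pair_le: "dim (span {u, v}) \<le> 2"
  and dim_span_triple_le: "dim (span {u, v, w}) \<le> 3"
  for u v w :: "'a::euclidean_space"
  by (simp_all add: dim_insert)

text \<open>If the barrier cone is a subspace, every direction in it has a finite width
  \<open>h (u) + h (- u)\<close>. The width ignores both translation and reflection, so any two directions can
  be compared on the plane they span, and the widths of \<open>K1\<close> are \<open>\<mu>\<close> times those of \<open>K2\<close> with one
  constant \<open>\<mu>\<close>. The sign alone may still vary: on each plane either \<open>h1 - \<mu> h2\<close> or its analogue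
  with \<open>K2\<close> reflected is linear. The dichotomy for additivity then settles the sign globally.\<close>
lemma support_match_UNIV_of_barrier_subspace:
  fixes K1 K2 :: "'a::euclidean_space set"
  assumes K: "K1 \<noteq> {}" "K2 \<noteq> {}" and B: "subspace (barrier_cone K1)"
    and match: "\<And>S. subspace S \<Longrightarrow> dim S \<le> 2 \<Longrightarrow>
      support_match S K1 K2 \<or> support_match S K1 (uminus ` K2)"
  shows "support_match UNIV K1 K2 \<or> support_match UNIV K1 (uminus ` K2)"
proof -
  define B where "B = barrier_cone K1"
  have sB: "subspace B"
    using B by (simp add: B_def)
  define h1 h2 h2' where "h1 = support_fun K1" and "h2 = support_fun K2"
    and "h2' = support_fun (uminus ` K2)"
  have h2': "h2' u = h2 (- u)" for u
    by (simp add: h2_def h2'_def support_fun_neg)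
  have neg: "- u \<in> B \<longleftrightarrow> u \<in> B" for u
    using sB subspace_neg[of B u] subspace_neg[of B "- u"] by auto
  have match2: "support_match (span {u, v}) K1 K2 \<or> support_match (span {u, v}) K1 (uminus ` K2)" for u v
    using match[OF subspace_span dim_span_pair_le] .
  have B2: "barrier_cone K2 = B"
  proof (rule set_eqI)
    fix u :: 'a
    have "u \<in> span {u, u}" "- u \<in> span {u, u}"
      by (simp_all add: span_base span_neg)
    then have "((u \<in> B \<longleftrightarrow> u \<in> barrier_cone K2) \<and> (- u \<in> B \<longleftrightarrow> - u \<in> barrier_cone K2)) \<or>
      ((u \<in> B \<longleftrightarrow> - u \<in> barrier_cone K2) \<and> (- u \<in> B \<longleftrightarrow> - (- u) \<in> barrier_cone K2))"
      using match2[of u u] unfolding support_match_def B_def barrier_cone_neg by blast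
    then show "u \<in> barrier_cone K2 \<longleftrightarrow> u \<in> B"
      using neg[of u] by auto
  qed
  have B2': "barrier_cone (uminus ` K2) = B"
    by (rule set_eqI) (simp add: barrier_cone_neg B2 neg)
  have K2': "uminus ` K2 \<noteq> {}"
    using K(2) by simp
  have two: "\<exists>c>0. \<exists>z. (\<forall>p\<in>span {u, v}. h1 p = p \<bullet> z + c * h2 p) \<or>
      (\<forall>p\<in>span {u, v}. h1 p = p \<bullet> z + c * h2' p)" if "u \<in> B" "v \<in> B" for u v
  proof -
    have "span {u, v} \<subseteq> B"
      using that by (intro span_minimal sB) simp
    then have inB: "p \<in> barrier_cone K1" if "p \<in> span {u, v}" for p
      using that by (auto simp: B_def)
    from match2[of u v] show ?thesis
    proof
      assume "support_match (span {u, v}) K1 K2"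
      then obtain z c where "c > 0" "\<forall>p\<in>span {u, v}. h1 p = p \<bullet> z + c * h2 p"
        unfolding support_match_def h1_def h2_def using inB by meson
      then show ?thesis by blast
    next
      assume "support_match (span {u, v}) K1 (uminus ` K2)"
      then obtain z c where "c > 0" "\<forall>p\<in>span {u, v}. h1 p = p \<bullet> z + c * h2' p"
        unfolding support_match_def h1_def h2'_def using inB by meson
      then show ?thesis by blast
    qed
  qed
  define w1 w2 where "w1 u = h1 u + h1 (- u)" and "w2 u = h2 u + h2 (- u)" for u
  have width: "w1 p = c * w2 p"
    if "(\<forall>p\<in>S. h1 p = p \<bullet> z + c * h2 p) \<or> (\<forall>p\<in>S. h1 p = p \<bullet> z + c * h2' p)"
      "p \<in> S" "- p \<in> S" for p c z S
    using that by (auto simp: w1_def w2_def h2' algebra_simps)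
  have width_pair: "w1 p = c * w2 p"
    if "(\<forall>p\<in>span {u, v}. h1 p = p \<bullet> z + c * h2 p) \<or> (\<forall>p\<in>span {u, v}. h1 p = p \<bullet> z + c * h2' p)"
      "p \<in> {u, v}" for p c z u v
    using width[OF that(1), of p] that(2) by (auto simp: span_base span_neg)
  \<comment> \<open>If all widths of \<open>K2\<close> vanish, so do those of \<open>K1\<close>, and any positive \<open>\<mu>\<close> will do.\<close>
  obtain \<mu> where "\<mu> > 0" and \<mu>: "\<And>v. v \<in> B \<Longrightarrow> w1 v = \<mu> * w2 v"
  proof (cases "\<exists>u\<in>B. w2 u \<noteq> 0")
    case True
    then obtain u where u: "u \<in> B" "w2 u \<noteq> 0"
      by blast
    obtain c z where c: "c > 0" and cz: "(\<forall>p\<in>span {u, u}. h1 p = p \<bullet> z + c * h2 p) \<or>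
        (\<forall>p\<in>span {u, u}. h1 p = p \<bullet> z + c * h2' p)"
      using two[OF u(1) u(1)] by blast
    have wu: "w1 u = c * w2 u"
      using width_pair[OF cz] by blast
    have "w1 v = c * w2 v" if v: "v \<in> B" for v
    proof -
      obtain c' z' where c': "(\<forall>p\<in>span {u, v}. h1 p = p \<bullet> z' + c' * h2 p) \<or>
          (\<forall>p\<in>span {u, v}. h1 p = p \<bullet> z' + c' * h2' p)"
        using two[OF u(1) v] by blast
      have "w1 u = c' * w2 u" "w1 v = c' * w2 v"
        using width_pair[OF c'] by blast+
      with wu u(2) show ?thesis
        by simp
    qed
    with c show ?thesis
      using that by blast
  next
    case False
    have "w1 v = 1 * w2 v" if v: "v \<in> B" for v
    proof -
      obtain c' z' where c': "(\<forall>p\<in>span {v, v}. h1 p = p \<bullet> z' + c' * h2 p) \<or>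
          (\<forall>p\<in>span {v, v}. h1 p = p \<bullet> z' + c' * h2' p)"
        using two[OF v v] by blast
      have "w1 v = c' * w2 v"
        using width_pair[OF c'] by blast
      with False v show ?thesis
        by simp
    qed
    then show ?thesis
      using that[of 1] by simp
  qed
  define P where "P = orth_proj B"
  have linP: "linear P"
    unfolding P_def by (rule linear_orth_proj[OF sB])
  have PB: "P u \<in> B" for u
    unfolding P_def by (rule orth_proj_foot(1)[OF plane_subspace[OF sB]])
  have Pid: "P u = u" if "u \<in> B" for u
    unfolding P_def by (rule orth_proj_subspace_id[OF sB that])
  \<comment> \<open>Composing with the projection on \<open>B\<close> gives finite convex functions on the whole space,
    which are therefore continuous.\<close>
  define f g where "f u = h1 (P u) - \<mu> * h2 (P u)" and "g u = h1 (P u) - \<mu> * h2' (P u)" for u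
  have cont: "continuous_on UNIV (\<lambda>u. h1 (P u))" "continuous_on UNIV (\<lambda>u. h2 (P u))"
    "continuous_on UNIV (\<lambda>u. h2' (P u))"
    unfolding h1_def h2_def h2'_def P_def
    using continuous_support_fun_orth_proj[OF _ sB] K K2' B2 B2' B_def by auto
  have hscale: "h1 (t *\<^sub>R u) = t * h1 u" "h2 (t *\<^sub>R u) = t * h2 u" "h2' (t *\<^sub>R u) = t * h2' u"
    if "t \<ge> 0" "u \<in> B" for t u
    using that K K2' B2 B2' unfolding h1_def h2_def h2'_def B_def
    by (simp_all add: support_fun_scaleR)
  have scale: "f (t *\<^sub>R u) = t * f u" "g (t *\<^sub>R u) = t * g u" if "t \<ge> 0" for t u
    using that linP
    by (simp_all add: f_def g_def linear_scale hscale PB right_diff_distrib)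
  have "(\<forall>u v. f (u + v) = f u + f v) \<or> (\<forall>u v. g (u + v) = g u + g v)"
  proof (rule additive_dichotomy)
    show "continuous_on UNIV f" "continuous_on UNIV g"
      unfolding f_def[abs_def] g_def[abs_def]
      by (intro continuous_on_diff continuous_on_mult continuous_on_const cont)+
  next
    fix u v
    obtain c z where cz: "(\<forall>p\<in>span {P u, P v}. h1 p = p \<bullet> z + c * h2 p) \<or>
        (\<forall>p\<in>span {P u, P v}. h1 p = p \<bullet> z + c * h2' p)"
      using two[OF PB PB] by blast
    have Pst: "P (s *\<^sub>R u + t *\<^sub>R v) = s *\<^sub>R P u + t *\<^sub>R P v" for s t
      using linP by (simp add: linear_add linear_scale)
    show "(\<forall>s\<ge>0. \<forall>t\<ge>0. f (s *\<^sub>R u + t *\<^sub>R v) = s * f u + t * f v) \<or>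
      (\<forall>s\<ge>0. \<forall>t\<ge>0. g (s *\<^sub>R u + t *\<^sub>R v) = s * g u + t * g v)"
    \<comment> \<open>Zero widths leave the ratio on this plane undetermined, but then both support functions are additive there.\<close>
    proof (cases "w2 (P u) = 0 \<and> w2 (P v) = 0")
      case True
      have "f (s *\<^sub>R u + t *\<^sub>R v) = s * f u + t * f v" if st: "s \<ge> 0" "t \<ge> 0" for s t
      proof -
        have sc: "r *\<^sub>R q \<in> B" if "q \<in> B" for r q
          using sB that by (rule subspace_scale)
        have w1z: "w1 (P u) = 0" "w1 (P v) = 0"
          using True \<mu>[OF PB] by simp_all
        have neg_scale: "h1 (- (r *\<^sub>R q)) = r * h1 (- q)" "h2 (- (r *\<^sub>R q)) = r * h2 (- q)"
          if "r \<ge> 0" "q \<in> B" for r q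
          using hscale[OF that(1), of "- q"] that(2) neg by simp_all
        have zero: "h1 (r *\<^sub>R q) + h1 (- (r *\<^sub>R q)) = 0" "h2 (r *\<^sub>R q) + h2 (- (r *\<^sub>R q)) = 0"
          if "r \<ge> 0" "q \<in> {P u, P v}" for r q
        proof -
          have "q \<in> B" "w1 q = 0" "w2 q = 0"
            using that(2) PB w1z True by auto
          then show "h1 (r *\<^sub>R q) + h1 (- (r *\<^sub>R q)) = 0" "h2 (r *\<^sub>R q) + h2 (- (r *\<^sub>R q)) = 0"
            using neg_scale[OF that(1)] hscale[OF that(1)]
            by (simp_all add: w1_def w2_def flip: distrib_left)
        qed
        have "h1 (s *\<^sub>R P u + t *\<^sub>R P v) = h1 (s *\<^sub>R P u) + h1 (t *\<^sub>R P v)"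
          unfolding h1_def
          by (rule support_fun_add_eq_zero_width[OF K(1)])
            (use zero st in \<open>simp_all add: B_def[symmetric] neg sc PB h1_def\<close>)
        moreover have "h2 (s *\<^sub>R P u + t *\<^sub>R P v) = h2 (s *\<^sub>R P u) + h2 (t *\<^sub>R P v)"
          unfolding h2_def
          by (rule support_fun_add_eq_zero_width[OF K(2)])
            (use zero st in \<open>simp_all add: B2 neg sc PB h2_def\<close>)
        ultimately show ?thesis
          unfolding f_def Pst using st by (simp add: hscale PB algebra_simps)
      qed
      then show ?thesis by blast
    next
      case False
      then obtain q where q: "q \<in> {P u, P v}" "w2 q \<noteq> 0"
        by blast
      have "w1 q = c * w2 q"
        using width_pair[OF cz q(1)] .
      moreover have "w1 q = \<mu> * w2 q"
        using \<mu> PB q(1) by blast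
      ultimately have c: "c = \<mu>"
        using q(2) by simp
      have mem: "P u \<in> span {P u, P v}" "P v \<in> span {P u, P v}"
        "s *\<^sub>R P u + t *\<^sub>R P v \<in> span {P u, P v}" for s t
        by (simp_all add: span_base span_add span_scale)
      from cz show ?thesis
      proof
        assume "\<forall>p\<in>span {P u, P v}. h1 p = p \<bullet> z + c * h2 p"
        then have "f (s *\<^sub>R u + t *\<^sub>R v) = s * f u + t * f v" for s t
          unfolding f_def Pst using mem by (simp add: c inner_add_left)
        then show ?thesis by blast
      next
        assume "\<forall>p\<in>span {P u, P v}. h1 p = p \<bullet> z + c * h2' p"
        then have "g (s *\<^sub>R u + t *\<^sub>R v) = s * g u + t * g v" for s t
          unfolding g_def Pst using mem by (simp add: c inner_add_left)
        then show ?thesis by blast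
      qed
    qed
  qed (rule scale; assumption)+
  then show ?thesis
  proof
    assume add: "\<forall>u v. f (u + v) = f u + f v"
    have "support_match UNIV K1 K2"
    proof (rule support_match_UNIV_of_additive[OF K _ \<open>\<mu> > 0\<close>])
      fix u v assume "u \<in> barrier_cone K1" "v \<in> barrier_cone K1"
      then have "P u = u" "P v = v" "P (u + v) = u + v"
        using Pid subspace_add[OF sB] by (simp_all add: B_def)
      with add[rule_format, of u v] show "support_fun K1 (u + v) - \<mu> * support_fun K2 (u + v) =
          (support_fun K1 u - \<mu> * support_fun K2 u) + (support_fun K1 v - \<mu> * support_fun K2 v)"
        by (simp add: f_def h1_def h2_def)
    qed (simp add: B2 B_def)
    then show ?thesis ..
  next
    assume add: "\<forall>u v. g (u + v) = g u + g v"
    have "support_match UNIV K1 (uminus ` K2)"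
    proof (rule support_match_UNIV_of_additive[OF K(1) K2' _ \<open>\<mu> > 0\<close>])
      fix u v assume "u \<in> barrier_cone K1" "v \<in> barrier_cone K1"
      then have "P u = u" "P v = v" "P (u + v) = u + v"
        using Pid subspace_add[OF sB] by (simp_all add: B_def)
      with add[rule_format, of u v] show
          "support_fun K1 (u + v) - \<mu> * support_fun (uminus ` K2) (u + v) =
          (support_fun K1 u - \<mu> * support_fun (uminus ` K2) u) +
          (support_fun K1 v - \<mu> * support_fun (uminus ` K2) v)"
        by (simp add: g_def h1_def h2'_def)
    qed (simp add: B2' B_def)
    then show ?thesis ..
  qed
qed

text \<open>The defect \<open>h (p) + h (q) - h (p + q)\<close> does not see linear functionals, so a match on the
  span of a triple makes the defects of \<open>K1\<close> a constant multiple of those of \<open>K2\<close> there. With a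
  common constant \<open>c\<close> for all pairs, \<open>h1 - c h2\<close> is additive.\<close>
lemma support_match_UNIV_of_triples:
  assumes K: "K1 \<noteq> {}" "K2 \<noteq> {}"
    and x: "x \<in> barrier_cone K1" "- x \<notin> barrier_cone K1"
    and triples: "\<And>u v w. u \<in> barrier_cone K1 \<Longrightarrow> - u \<notin> barrier_cone K1 \<Longrightarrow>
      support_match (span {u, v, w}) K1 K2"
  shows "support_match UNIV K1 K2"
proof -
  define B where "B = barrier_cone K1"
  define N where "N = {u \<in> B. - u \<notin> B}"
  have Badd: "u + v \<in> B" if "u \<in> B" "v \<in> B" for u v
    using that unfolding B_def by (rule barrier_cone_add)
  have Nadd: "u + v \<in> N" if "u \<in> N" "v \<in> B" for u v
  proof -
    have "- (u + v) \<notin> B"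
      using Badd[of "- (u + v)" v] that by (auto simp: N_def)
    then show ?thesis
      using that Badd by (simp add: N_def)
  qed
  have N: "N \<subseteq> B" "x \<in> N"
    using x by (auto simp: N_def B_def)
  have B2: "barrier_cone K1 = barrier_cone K2"
  proof (rule set_eqI)
    fix u
    have "u \<in> span {x, u, u}"
      by (simp add: span_base)
    with triples[OF x, of u u] show "u \<in> barrier_cone K1 \<longleftrightarrow> u \<in> barrier_cone K2"
      unfolding support_match_def by blast
  qed
  have "\<exists>c>0. \<forall>p\<in>B. \<forall>q\<in>B. support_fun K1 p + support_fun K1 q - support_fun K1 (p + q) =
      c * (support_fun K2 p + support_fun K2 q - support_fun K2 (p + q))"
  proof (rule common_defect_ratio[OF Badd N Nadd])
    fix u v w assume "u \<in> N" "v \<in> B" "w \<in> B"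
    then have "u \<in> barrier_cone K1" "- u \<notin> barrier_cone K1"
      by (auto simp: N_def B_def)
    from triples[OF this, of v w] obtain z c where "c > 0"
      and *: "\<And>p. p \<in> B \<Longrightarrow> p \<in> span {u, v, w} \<Longrightarrow> support_fun K1 p = p \<bullet> z + c * support_fun K2 p"
      unfolding support_match_def B_def by blast
    have "support_fun K1 p + support_fun K1 q - support_fun K1 (p + q) =
        c * (support_fun K2 p + support_fun K2 q - support_fun K2 (p + q))"
      if "p \<in> B \<inter> span {u, v, w}" "q \<in> B \<inter> span {u, v, w}" for p q
      using *[of p] *[of q] *[of "p + q"] that Badd[of p q] span_add[of p "{u, v, w}" q]
      by (simp add: inner_add_left algebra_simps)
    with \<open>c > 0\<close> show "\<exists>c>0. \<forall>p\<in>B \<inter> span {u, v, w}. \<forall>q\<in>B \<inter> span {u, v, w}.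
        support_fun K1 p + support_fun K1 q - support_fun K1 (p + q) =
        c * (support_fun K2 p + support_fun K2 q - support_fun K2 (p + q))"
      by blast
  qed
  then obtain c where "c > 0" and c: "\<And>p q. p \<in> B \<Longrightarrow> q \<in> B \<Longrightarrow>
      support_fun K1 p + support_fun K1 q - support_fun K1 (p + q) =
      c * (support_fun K2 p + support_fun K2 q - support_fun K2 (p + q))"
    by blast
  show ?thesis
  proof (rule support_match_UNIV_of_additive[OF K B2 \<open>c > 0\<close>])
    fix u v assume "u \<in> barrier_cone K1" "v \<in> barrier_cone K1"
    from c[of u v] this show "support_fun K1 (u + v) - c * support_fun K2 (u + v) =
      (support_fun K1 u - c * support_fun K2 u) + (support_fun K1 v - c * support_fun K2 v)"
      by (simp add: B_def algebra_simps)
  qed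
qed

text \<open>A direction \<open>x\<close> in which \<open>K1\<close> is bounded above but not below fixes the sign of the ratio on
  every subspace through \<open>x\<close>. Applied to the spans of \<open>x\<close> and a further vector, this identifies the
  barrier cones of \<open>K1\<close> and the correctly signed \<open>K2\<close>; hence every other such direction of \<open>K1\<close>
  forces the same sign.\<close>
lemma support_match_UNIV_of_pointed_barrier:
  assumes K: "K1 \<noteq> {}" "K2 \<noteq> {}"
    and x: "x \<in> barrier_cone K1" "- x \<notin> barrier_cone K1"
    and match: "\<And>S. subspace S \<Longrightarrow> dim S \<le> 3 \<Longrightarrow>
      support_match S K1 K2 \<or> support_match S K1 (uminus ` K2)"
  shows "support_match UNIV K1 K2 \<or> support_match UNIV K1 (uminus ` K2)"
proof -
  have *: "support_match UNIV K1 K"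
    if K: "K \<noteq> {}" and xK: "x \<in> barrier_cone K" "- x \<notin> barrier_cone K"
      and match': "\<And>S. subspace S \<Longrightarrow> dim S \<le> 3 \<Longrightarrow>
        support_match S K1 K \<or> support_match S K1 (uminus ` K)" for K
  proof (rule support_match_UNIV_of_triples[OF assms(1) K x])
    have fixed_sign: "support_match (span {u, v, w}) K1 K"
      if "u \<in> barrier_cone K1" "u \<in> barrier_cone K" "- u \<notin> barrier_cone K" for u v w
    proof -
      have "u \<in> span {u, v, w}"
        by (simp add: span_base)
      then have "\<not> support_match (span {u, v, w}) K1 (uminus ` K)"
        using that unfolding support_match_def barrier_cone_neg by blast
      then show ?thesis
        using match'[OF subspace_span dim_span_triple_le] by blast
    qed
    fix u v w assume u: "u \<in> barrier_cone K1" "- u \<notin> barrier_cone K1"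
    have "u \<in> span {x, u, u}" "- u \<in> span {x, u, u}"
      by (simp_all add: span_base span_neg)
    then have "u \<in> barrier_cone K" "- u \<notin> barrier_cone K"
      using fixed_sign[OF x(1) xK, of u u] u unfolding support_match_def by blast+
    then show "support_match (span {u, v, w}) K1 K"
      using fixed_sign u(1) by blast
  qed
  have xs: "x \<in> span {x, x, x}" "- x \<in> span {x, x, x}"
    by (simp_all add: span_base span_neg)
  from match[OF subspace_span dim_span_triple_le[of x x x]] show ?thesis
  proof
    assume "support_match (span {x, x, x}) K1 K2"
    then have "x \<in> barrier_cone K2" "- x \<notin> barrier_cone K2"
      using xs x unfolding support_match_def by blast+
    from *[OF K(2) this match] show ?thesis by blast
  next
    assume "support_match (span {x, x, x}) K1 (uminus ` K2)"
    then have "x \<in> barrier_cone (uminus ` K2)" "- x \<notin> barrier_cone (uminus ` K2)"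
      using xs x unfolding support_match_def by blast+
    moreover have "support_match S K1 (uminus ` K2) \<or> support_match S K1 (uminus ` uminus ` K2)"
      if "subspace S" "dim S \<le> 3" for S
      using match[OF that] by (auto simp: image_image)
    ultimately show ?thesis
      using *[of "uminus ` K2"] K(2) by blast
  qed
qed

section \<open>Convex sets with homothetic projections\<close>

lemma subspace_extend_dim:
  fixes S :: "'a::euclidean_space set"
  assumes "subspace S" "dim S \<le> m" "m \<le> DIM('a)"
  obtains T where "subspace T" "S \<subseteq> T" "dim T = m"
proof -
  have "\<exists>T. subspace T \<and> S \<subseteq> T \<and> dim T = m"
    using assms(2,3)
  proof (induction m rule: dec_induct)
    case base
    then show ?case
      using assms(1) by blast
  next
    case (step k)
    then obtain T where T: "subspace T" "S \<subseteq> T" "dim T = k"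
      by auto
    have "T \<noteq> UNIV"
      using T(3) step by auto
    then obtain x where "x \<notin> T"
      by blast
    then have "dim (span (insert x T)) = Suc k"
      using T(1,3) by (simp add: dim_insert span_eq_iff[THEN iffD2])
    moreover have "S \<subseteq> span (insert x T)"
      using T(2) by (auto intro: span_base)
    ultimately show ?case
      using subspace_span by blast
  qed
  then show ?thesis
    using that by blast
qed

lemma support_match_of_homothetic_projections:
  fixes K1 K2 :: "'a::euclidean_space set"
  assumes "K2 \<noteq> {}" "m \<le> DIM('a)"
    and proj: "\<And>L. plane m L \<Longrightarrow> homothetic (orth_proj L ` K1) (orth_proj L ` K2)"
    and S: "subspace S" "dim S \<le> m"
  shows "support_match S K1 K2 \<or> support_match S K1 (uminus ` K2)"
proof -
  obtain T where T: "subspace T" "S \<subseteq> T" "dim T = m"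
    using subspace_extend_dim[OF S assms(2)] by blast
  have "plane m T"
    using plane_subspace[OF T(1)] T(3) by simp
  from support_match_of_homothetic_orth_proj[OF T(1) assms(1) proj[OF this]] show ?thesis
    using support_match_mono[OF _ T(2)] by blast
qed

theorem theorem1:
  fixes K1 K2 :: "(real ^ 'n) set" and m :: nat
  assumes "K1 \<noteq> {}" "K2 \<noteq> {}" "convex K1" "convex K2"
    and "compact K1 \<and> compact K2 \<and> 2 \<le> m \<and> m \<le> CARD('n) - 1 \<or>
         closed K1 \<and> closed K2 \<and> 3 \<le> m \<and> m \<le> CARD('n) - 1"
  shows "homothetic K1 K2 \<longleftrightarrow>
    (\<forall>L. plane m L \<longrightarrow> homothetic (orth_proj L ` K1) (orth_proj L ` K2))"
proof
  assume "homothetic K1 K2"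
  then show "\<forall>L. plane m L \<longrightarrow> homothetic (orth_proj L ` K1) (orth_proj L ` K2)"
    using homothetic_orth_proj by blast
next
  assume "\<forall>L. plane m L \<longrightarrow> homothetic (orth_proj L ` K1) (orth_proj L ` K2)"
  moreover have "m \<le> DIM(real ^ 'n)"
    using assms(5) by auto
  ultimately have match: "support_match S K1 K2 \<or> support_match S K1 (uminus ` K2)"
    if "subspace S" "dim S \<le> m" for S
    using support_match_of_homothetic_projections[OF assms(2) _ _ that] by blast
  have closed: "closed K1" "closed K2" and "2 \<le> m"
    using assms(5) compact_imp_closed by auto
  have "support_match UNIV K1 K2 \<or> support_match UNIV K1 (uminus ` K2)"
  proof (cases "subspace (barrier_cone K1)")
    case True
    have "support_match S K1 K2 \<or> support_match S K1 (uminus ` K2)"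
      if "subspace S" "dim S \<le> 2" for S
      using match[OF that(1)] that(2) \<open>2 \<le> m\<close> by simp
    from support_match_UNIV_of_barrier_subspace[OF assms(1,2) True this] show ?thesis .
  next
    case False
    have "\<exists>x\<in>barrier_cone K1. - x \<notin> barrier_cone K1"
    proof (rule ccontr)
      assume *: "\<not> ?thesis"
      have "subspace (barrier_cone K1)"
      proof (rule subspaceI)
        fix c :: real and u assume u: "u \<in> barrier_cone K1"
        show "c *\<^sub>R u \<in> barrier_cone K1"
        proof (cases "c \<ge> 0")
          case True
          then show ?thesis
            by (rule barrier_cone_scaleR[OF assms(1) u])
        next
          case False
          then show ?thesis
            using barrier_cone_scaleR[OF assms(1), of "- u" "- c"] * u by auto
        qed
      qed (simp_all add: barrier_cone_add)
      with False show False ..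
    qed
    then obtain x where x: "x \<in> barrier_cone K1" "- x \<notin> barrier_cone K1"
      by blast
    \<comment> \<open>A linear functional is bounded on a compact set, so the compact case has the whole space as barrier cone.\<close>
    have "\<not> compact K1"
    proof
      assume "compact K1"
      then have "compact ((\<bullet>) (- x) ` K1)"
        by (intro compact_continuous_image continuous_intros)
      then have "- x \<in> barrier_cone K1"
        unfolding barrier_cone_def mem_Collect_eq
        by (intro bounded_imp_bdd_above compact_imp_bounded)
      with x(2) show False ..
    qed
    then have "3 \<le> m"
      using assms(5) by blast
    have "support_match S K1 K2 \<or> support_match S K1 (uminus ` K2)"
      if "subspace S" "dim S \<le> 3" for S
      using match[OF that(1)] that(2) \<open>3 \<le> m\<close> by simp
    from support_match_UNIV_of_pointed_barrier[OF assms(1,2) x this] show ?thesis .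
  qed
  then show "homothetic K1 K2"
  proof
    assume "support_match UNIV K1 K2"
    then show ?thesis
      by (rule homothetic_of_support_match_UNIV[OF closed(1) assms(3,1) closed(2) assms(4,2)])
  next
    assume "support_match UNIV K1 (uminus ` K2)"
    moreover have "closed (uminus ` K2)" "convex (uminus ` K2)" "uminus ` K2 \<noteq> {}"
      using closed(2) assms(2,4) by (simp_all add: closed_negations convex_negations)
    ultimately have "homothetic K1 (uminus ` K2)"
      by (intro homothetic_of_support_match_UNIV[OF closed(1) assms(3,1)])
    then show ?thesis
      by (rule homothetic_uminus)
  qed
qed

end
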